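(* Let $F$ be a field of characteristic $\neq 2$ and let $V$ be a two-dimensional $F$-vector space with a nonzero skew-symmetric bilinear form $\langle\cdot|\cdot\rangle$. Let $S_8=(V\otimes V)\oplus(V\otimes V)$ with the bilinear product determined by $$(a\otimes b,c\otimes d)\bullet(a'\otimes b',c'\otimes d')=\Bigl(\langle b|a'\rangle\, b'\otimes a-\langle d|d'\rangle\, c\otimes c',\ -\langle a|c'\rangle\, b\otimes d'-\langle c|b'\rangle\, a'\otimes d\Bigr)$$ for $a,b,c,d,a',b',c',d'\in V$, and with the quadratic form $q$ whose polar form is $$q\bigl((a\otimes b,c\otimes d),(a'\otimes b',c'\otimes d')\bigr)=\langle a|a'\rangle\langle b|b'\rangle+\langle c|c'\rangle\langle d|d'\rangle .$$ Then $(S_8,\bullet,q)$ is the split para-octonion algebra over $F$, i.e. it is isomorphic (by an isomorphism of algebras that is an isometry of the norms) to the para-Hurwitz algebra associated with the split Cayley algebra over $F$. Moreover the first copy of $V\otimes V$ in $S_8$ is a subalgebra $S_4$ which (with the restriction of $q$) is the split para-quaternion algebra, i.e. the para-Hurwitz algebra associated with the split quaternion algebra $\mathrm{End}_F(V)\cong M_2(F)$.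
   Context: A Hurwitz algebra is a unital composition algebra $C$ (a unital, possibly nonassociative algebra with a regular quadratic form $q$, the norm, satisfying $q(xy)=q(x)q(y)$); its standard involution is $\bar x=q(x,1)1-x$, where $q(x,y)=q(x+y)-q(x)-q(y)$ is the polar form (denoted by the same letter). The para-Hurwitz algebra associated with $C$ is the vector space $C$ with the same norm and the new product $x\bullet y=\bar x\,\bar y$. The split Cayley algebra over $F$ is the 8-dimensional Hurwitz algebra obtained by the Cayley–Dickson process from the split quaternion algebra $Q=M_2(F)$ (norm $\det$): $C=Q\oplus Q$ with $(x,y)(x',y')=(xx'-\overline{y'}y,\ y'x+y\overline{x'})$, $\overline{(x,y)}=(\bar x,-y)$, $q((x,y))=q(x)+q(y)$. The product displayed in the claim is understood as the bilinear extension of the four component maps $(V\otimes V)\times(V\otimes V)\to V\otimes V$ appearing in it, and the polar form likewise. *)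

theory Defs
  imports "HOL-Analysis.Analysis" "HOL-Library.Function_Algebras"
begin

section \<open>Bilinear maps, quadratic forms, tensor products\<close>

text \<open>A vector space over the field \<open>'f\<close> is a type with a scalar multiplication satisfying
  \<^const>\<open>vector_space\<close>.  The field itself is the vector space with scalar multiplication \<open>(*)\<close>.\<close>

definition bilinear_map ::
  "('f::field \<Rightarrow> 'u::ab_group_add \<Rightarrow> 'u) \<Rightarrow> ('f \<Rightarrow> 'v::ab_group_add \<Rightarrow> 'v) \<Rightarrow>
   ('f \<Rightarrow> 'w::ab_group_add \<Rightarrow> 'w) \<Rightarrow> ('u \<Rightarrow> 'v \<Rightarrow> 'w) \<Rightarrow> bool" where
  "bilinear_map sU sV sW f \<longleftrightarrow>
     (\<forall>u. Vector_Spaces.linear sV sW (\<lambda>v. f u v)) \<and>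
     (\<forall>v. Vector_Spaces.linear sU sW (\<lambda>u. f u v))"

definition polar :: "('x::ab_group_add \<Rightarrow> 'f::field) \<Rightarrow> 'x \<Rightarrow> 'x \<Rightarrow> 'f" where
  "polar q x y = q (x + y) - q x - q y"

definition quadratic_form ::
  "('f::field \<Rightarrow> 'x::ab_group_add \<Rightarrow> 'x) \<Rightarrow> ('x \<Rightarrow> 'f) \<Rightarrow> bool" where
  "quadratic_form s q \<longleftrightarrow> (\<forall>c x. q (s c x) = c ^ 2 * q x) \<and> bilinear_map s s (*) (polar q)"

text \<open>The tensor product is given by its universal property, so that statements about it hold for
  every model.  A bound variable cannot range over vector spaces on arbitrary types; the property is
  therefore required for bilinear maps into the ground field only.  Over a field this implies the
  full universal property, see \<open>tensor_product_universal\<close> below.\<close>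

definition is_tensor_product ::
  "('f::field \<Rightarrow> 'u::ab_group_add \<Rightarrow> 'u) \<Rightarrow> ('f \<Rightarrow> 'v::ab_group_add \<Rightarrow> 'v) \<Rightarrow>
   ('f \<Rightarrow> 't::ab_group_add \<Rightarrow> 't) \<Rightarrow> ('u \<Rightarrow> 'v \<Rightarrow> 't) \<Rightarrow> bool" where
  "is_tensor_product sU sV sT tens \<longleftrightarrow>
     bilinear_map sU sV sT tens \<and>
     (\<forall>f. bilinear_map sU sV (*) f \<longrightarrow>
        (\<exists>!g. Vector_Spaces.linear sT (*) g \<and> (\<forall>u v. g (tens u v) = f u v)))"

lemma vector_space_field: "vector_space ((*) :: 'f::field \<Rightarrow> 'f \<Rightarrow> 'f)"
  by unfold_locales (auto simp: algebra_simps)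

lemma tensor_product_universal:
  fixes sU :: "'f::field \<Rightarrow> 'u::ab_group_add \<Rightarrow> 'u"
    and sV :: "'f \<Rightarrow> 'v::ab_group_add \<Rightarrow> 'v"
    and sT :: "'f \<Rightarrow> 't::ab_group_add \<Rightarrow> 't"
    and sW :: "'f \<Rightarrow> 'w::ab_group_add \<Rightarrow> 'w"
  assumes T: "is_tensor_product sU sV sT tens" and f: "bilinear_map sU sV sW f"
  shows "\<exists>!g. Vector_Spaces.linear sT sW g \<and> (\<forall>u v. g (tens u v) = f u v)"
proof -
  have tb: "bilinear_map sU sV sT tens"
    and univ: "\<And>h. bilinear_map sU sV (*) h \<Longrightarrow>
        \<exists>!g. Vector_Spaces.linear sT (*) g \<and> (\<forall>u v. g (tens u v) = h u v)"
    using T by (auto simp: is_tensor_product_def)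
  interpret U: vector_space sU using f by (auto simp: bilinear_map_def Vector_Spaces.linear_iff)
  interpret V: vector_space sV using f by (auto simp: bilinear_map_def Vector_Spaces.linear_iff)
  interpret W: vector_space sW using f by (auto simp: bilinear_map_def Vector_Spaces.linear_iff)
  interpret T: vector_space sT using tb by (auto simp: bilinear_map_def Vector_Spaces.linear_iff)
  interpret F: vector_space "(*) :: 'f \<Rightarrow> 'f \<Rightarrow> 'f" by (rule vector_space_field)
  interpret TF: vector_space_pair sT "(*) :: 'f \<Rightarrow> 'f \<Rightarrow> 'f" ..
  interpret TW: vector_space_pair sT sW ..
  interpret UW: vector_space_pair sU sW ..
  interpret VW: vector_space_pair sV sW ..
  have vU: "vector_space sU" and vV: "vector_space sV" and vT: "vector_space sT"
    and vW: "vector_space sW" by unfold_locales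
  define S where "S = {tens u v | u v. True}"
  have spanS: "T.span S = UNIV"
  proof (rule ccontr)
    assume "T.span S \<noteq> UNIV"
    then obtain x where x: "x \<notin> T.span S" by auto
    obtain B where B: "B \<subseteq> S" "T.independent B" "S \<subseteq> T.span B"
      using T.maximal_independent_subset[of S] by blast
    have sB: "T.span B = T.span S"
      using B T.span_eq T.span_superset by (metis subset_trans)
    have ind: "T.independent (insert x B)"
      using x B(2) by (simp add: T.independent_insertI sB)
    define h where "h = TF.construct (insert x B) (\<lambda>b. if b = x then 1 else 0)"
    have hl: "Vector_Spaces.linear sT (*) h"
      unfolding h_def by (rule TF.linear_construct[OF ind])
    have hx: "h x = 1" unfolding h_def by (subst TF.construct_basis[OF ind]) auto
    have hB: "h b = 0" if "b \<in> B" for b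
    proof -
      have "b \<noteq> x" using that x sB T.span_base by metis
      then show ?thesis unfolding h_def using that by (subst TF.construct_basis[OF ind]) auto
    qed
    have hS: "h y = 0" if "y \<in> T.span B" for y
      by (rule TF.linear_eq_0_on_span[OF hl]) (use hB that in auto)
    have h0: "h (tens u v) = 0" for u v
    proof (rule hS)
      have "tens u v \<in> S" by (auto simp: S_def)
      then show "tens u v \<in> T.span B" unfolding sB by (rule T.span_base)
    qed
    have z: "Vector_Spaces.linear sT (*) (\<lambda>_. 0::'f)"
      using vT vector_space_field by (auto simp: Vector_Spaces.linear_iff)
    have "bilinear_map sU sV (*) (\<lambda>_ _. 0::'f)"
      using vU vV vector_space_field by (auto simp: bilinear_map_def Vector_Spaces.linear_iff)
    from univ[OF this] hl z h0 have "h = (\<lambda>_. 0)" by blast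
    with hx show False by simp
  qed
  obtain BU where BU: "U.independent BU" "U.span BU = UNIV"
    by (rule U.maximal_independent_subset[of UNIV]) auto
  obtain BV where BV: "V.independent BV" "V.span BV = UNIV"
    by (rule V.maximal_independent_subset[of UNIV]) auto
  define P where "P = BU \<times> BV"
  define E where "E = (\<lambda>(b, c). tens b c) ` P"
  have dual: "\<exists>g. Vector_Spaces.linear sT (*) g \<and>
      (\<forall>b\<in>BU. \<forall>c\<in>BV. g (tens b c) = (if b = b0 \<and> c = c0 then 1 else 0))"
    if "b0 \<in> BU" "c0 \<in> BV" for b0 c0
  proof -
    let ?r = "\<lambda>u v. U.representation BU u b0 * V.representation BV v c0"
    have "bilinear_map sU sV (*) ?r"
      using vU vV vector_space_field BU BV
      by (auto simp: bilinear_map_def Vector_Spaces.linear_iff U.representation_add V.representation_add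
          U.representation_scale V.representation_scale algebra_simps)
    from univ[OF this] obtain g where
      g: "Vector_Spaces.linear sT (*) g" "\<And>u v. g (tens u v) = ?r u v" by blast
    have "g (tens b c) = (if b = b0 \<and> c = c0 then 1 else 0)" if "b \<in> BU" "c \<in> BV" for b c
      using that BU BV by (simp add: g(2) U.representation_basis V.representation_basis)
    with g(1) show ?thesis by blast
  qed
  have inj: "inj_on (\<lambda>(b, c). tens b c) P"
  proof (rule inj_onI, clarsimp simp: P_def)
    fix b c b' c' assume *: "b \<in> BU" "c \<in> BV" "b' \<in> BU" "c' \<in> BV" "tens b c = tens b' c'"
    from dual[OF *(1,2)] obtain g where
      "\<forall>x\<in>BU. \<forall>y\<in>BV. g (tens x y) = (if x = b \<and> y = c then 1 else (0::'f))" by blast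
    then show "b = b' \<and> c = c'" using * by (metis zero_neq_one)
  qed
  have indE: "T.independent E"
    unfolding T.dependent_def
  proof clarsimp
    fix e assume e: "e \<in> E" "e \<in> T.span (E - {e})"
    then obtain b c where bc: "b \<in> BU" "c \<in> BV" "e = tens b c" by (auto simp: E_def P_def)
    from dual[OF bc(1,2)] obtain g where gl: "Vector_Spaces.linear sT (*) g" and
      g: "\<And>x y. x \<in> BU \<Longrightarrow> y \<in> BV \<Longrightarrow> g (tens x y) = (if x = b \<and> y = c then 1 else (0::'f))"
      by blast
    have "g e = 0"
      by (rule TF.linear_eq_0_on_span[OF gl _ e(2)]) (auto simp: E_def P_def g bc(3))
    with g[OF bc(1,2)] bc(3) show False by simp
  qed
  define k where "k e = (case the_inv_into P (\<lambda>(b, c). tens b c) e of (b, c) \<Rightarrow> f b c)" for e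
  define g where "g = TW.construct E k"
  have gl: "Vector_Spaces.linear sT sW g"
    unfolding g_def by (rule TW.linear_construct[OF indE])
  have gE: "g (tens b c) = f b c" if "b \<in> BU" "c \<in> BV" for b c
  proof -
    have "(b, c) \<in> P" using that by (simp add: P_def)
    then have "the_inv_into P (\<lambda>(b, c). tens b c) (tens b c) = (b, c)" "tens b c \<in> E"
      using the_inv_into_f_f[OF inj, of "(b, c)"] by (force simp: E_def)+
    then show ?thesis unfolding g_def by (simp add: TW.construct_basis[OF indE] k_def)
  qed
  have gtU: "Vector_Spaces.linear sU sW (\<lambda>u. g (tens u v))" for v
    using gl tb by (auto simp: bilinear_map_def Vector_Spaces.linear_iff)
  have gtV: "Vector_Spaces.linear sV sW (\<lambda>v. g (tens u v))" for u
    using gl tb by (auto simp: bilinear_map_def Vector_Spaces.linear_iff)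
  have fU: "Vector_Spaces.linear sU sW (\<lambda>u. f u v)" and fV: "Vector_Spaces.linear sV sW (\<lambda>v. f u v)"
    for u v using f by (auto simp: bilinear_map_def)
  have g1: "g (tens b v) = f b v" if "b \<in> BU" for b v
    by (rule VW.linear_eq_on[OF gtV fV, of v BV]) (use that gE BV in auto)
  have g2: "g (tens u v) = f u v" for u v
    by (rule UW.linear_eq_on[OF gtU fU, of u BU]) (use g1 BU in auto)
  have "g' = g" if "Vector_Spaces.linear sT sW g'" "\<forall>u v. g' (tens u v) = f u v" for g'
  proof
    fix x show "g' x = g x"
      by (rule TW.linear_eq_on[OF that(1) gl, of x S]) (use spanS that(2) g2 in \<open>auto simp: S_def\<close>)
  qed
  with gl g2 show ?thesis by blast
qed


section \<open>Hurwitz and para-Hurwitz algebras\<close>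

text \<open>Algebras are given by scalar multiplication \<open>s\<close>, product \<open>m\<close>, unit \<open>e\<close> and norm \<open>q\<close>.\<close>

definition hurwitz_algebra ::
  "('f::field \<Rightarrow> 'x::ab_group_add \<Rightarrow> 'x) \<Rightarrow> ('x \<Rightarrow> 'x \<Rightarrow> 'x) \<Rightarrow> 'x \<Rightarrow> ('x \<Rightarrow> 'f) \<Rightarrow> bool" where
  "hurwitz_algebra s m e q \<longleftrightarrow>
     bilinear_map s s s m \<and> (\<forall>x. m e x = x \<and> m x e = x) \<and>
     quadratic_form s q \<and> (\<forall>x. (\<forall>y. polar q x y = 0) \<longrightarrow> x = 0) \<and>
     (\<forall>x y. q (m x y) = q x * q y)"

definition std_inv ::
  "('f::field \<Rightarrow> 'x::ab_group_add \<Rightarrow> 'x) \<Rightarrow> 'x \<Rightarrow> ('x \<Rightarrow> 'f) \<Rightarrow> 'x \<Rightarrow> 'x" where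
  "std_inv s e q x = s (polar q x e) e - x"

definition para_mult ::
  "('f::field \<Rightarrow> 'x::ab_group_add \<Rightarrow> 'x) \<Rightarrow> ('x \<Rightarrow> 'x \<Rightarrow> 'x) \<Rightarrow> 'x \<Rightarrow> ('x \<Rightarrow> 'f) \<Rightarrow>
   'x \<Rightarrow> 'x \<Rightarrow> 'x" where
  "para_mult s m e q x y = m (std_inv s e q x) (std_inv s e q y)"

text \<open>Cayley--Dickson doubling of an algebra with involution \<open>bar\<close> and norm \<open>q\<close>.\<close>

definition cd_mult ::
  "('x::ab_group_add \<Rightarrow> 'x \<Rightarrow> 'x) \<Rightarrow> ('x \<Rightarrow> 'x) \<Rightarrow> 'x \<times> 'x \<Rightarrow> 'x \<times> 'x \<Rightarrow> 'x \<times> 'x" where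
  "cd_mult m bar = (\<lambda>(x, y) (x', y'). (m x x' - m (bar y') y, m y' x + m y (bar x')))"

definition cd_norm :: "('x \<Rightarrow> 'f::field) \<Rightarrow> 'x \<times> 'x \<Rightarrow> 'f" where
  "cd_norm q = (\<lambda>(x, y). q x + q y)"

text \<open>The split quaternion algebra is the algebra of 2 by 2 matrices with norm \<^const>\<open>det\<close>; its
  double, with unit \<open>(mat 1, 0)\<close>, is the split Cayley algebra.\<close>

type_synonym 'f quat = "'f^2^2"

definition quat_scale :: "'f::field \<Rightarrow> 'f quat \<Rightarrow> 'f quat" where
  "quat_scale c = map_matrix ((*) c)"

definition quat_bar :: "'f::field quat \<Rightarrow> 'f quat" where
  "quat_bar = std_inv quat_scale (mat 1) det"

definition para_quat_mult :: "'f::field quat \<Rightarrow> 'f quat \<Rightarrow> 'f quat" where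
  "para_quat_mult = para_mult quat_scale (**) (mat 1) det"

definition cayley_scale :: "'f::field \<Rightarrow> 'f quat \<times> 'f quat \<Rightarrow> 'f quat \<times> 'f quat" where
  "cayley_scale = module_prod.scale quat_scale quat_scale"

definition cayley_mult :: "'f::field quat \<times> 'f quat \<Rightarrow> 'f quat \<times> 'f quat \<Rightarrow> 'f quat \<times> 'f quat" where
  "cayley_mult = cd_mult (**) quat_bar"

definition cayley_norm :: "'f::field quat \<times> 'f quat \<Rightarrow> 'f" where
  "cayley_norm = cd_norm det"

definition para_cayley_mult ::
  "'f::field quat \<times> 'f quat \<Rightarrow> 'f quat \<times> 'f quat \<Rightarrow> 'f quat \<times> 'f quat" where
  "para_cayley_mult = para_mult cayley_scale cayley_mult (mat 1, 0) cayley_norm"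

lemma vector_space_quat: "vector_space (quat_scale :: 'f::field \<Rightarrow> _)"
  by unfold_locales (auto simp: quat_scale_def vec_eq_iff algebra_simps)

lemma vector_space_pair_quat:
  "vector_space_pair (quat_scale :: 'f::field \<Rightarrow> _) (quat_scale :: 'f \<Rightarrow> _)"
  using vector_space_quat by (simp add: vector_space_pair_def)

lemma module_prod_quat: "module_prod (quat_scale :: 'f::field \<Rightarrow> _) (quat_scale :: 'f \<Rightarrow> _)"
  using vector_space_quat
  by (simp add: module_prod_def module_pair_def module_iff_vector_space)

lemma cayley_scale_apply: "cayley_scale c (x, y) = (quat_scale c x, quat_scale c y)"
  by (simp add: cayley_scale_def module_prod.scale_def[OF module_prod_quat])

lemma vector_space_cayley: "vector_space (cayley_scale :: 'f::field \<Rightarrow> _)"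
  by unfold_locales
    (auto simp: cayley_scale_apply quat_scale_def vec_eq_iff algebra_simps split: prod.splits)

lemma std_inv_cayley:
  "std_inv cayley_scale (mat 1, 0) cayley_norm (x, y) = (quat_bar x, - y :: 'f::field quat)"
  by (simp add: std_inv_def cayley_scale_apply quat_bar_def polar_def cayley_norm_def cd_norm_def
      quat_scale_def vec_eq_iff det_2)

lemma polar_det:
  "polar det x (y :: 'f::field quat) = x$1$1 * y$2$2 + x$2$2 * y$1$1 - x$1$2 * y$2$1 - x$2$1 * y$1$2"
  by (simp add: polar_def det_2 algebra_simps)

lemma polar_cayley_norm:
  "polar cayley_norm (x, y) (x', y' :: 'f::field quat) = polar det x x' + polar det y y'"
  by (simp add: polar_def cayley_norm_def cd_norm_def)

lemma quat_bar_nth: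
  fixes x :: "'f::field quat"
  shows "quat_bar x $ 1 $ 1 = x$2$2" "quat_bar x $ 2 $ 2 = x$1$1"
    "quat_bar x $ 1 $ 2 = - x$1$2" "quat_bar x $ 2 $ 1 = - x$2$1"
  by (simp_all add: quat_bar_def std_inv_def polar_det quat_scale_def mat_def)

lemma quat_mult_nth: "((x :: 'f::field quat) ** y) $ i $ j = x$i$1 * y$1$j + x$i$2 * y$2$j"
  by (simp add: matrix_matrix_mult_def sum_2)

lemma polar_det_nondegenerate:
  fixes x :: "'f::field quat"
  assumes "\<And>y. polar det x y = 0"
  shows "x = 0"
proof -
  have "x$1$1 = 0" using assms[of "\<chi> i j. if i = 2 \<and> j = 2 then 1 else 0"] by (simp add: polar_det)
  moreover have "x$2$2 = 0"
    using assms[of "\<chi> i j. if i = 1 \<and> j = 1 then 1 else 0"] by (simp add: polar_det)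
  moreover have "x$1$2 = 0"
    using assms[of "\<chi> i j. if i = 2 \<and> j = 1 then 1 else 0"] by (simp add: polar_det)
  moreover have "x$2$1 = 0"
    using assms[of "\<chi> i j. if i = 1 \<and> j = 2 then 1 else 0"] by (simp add: polar_det)
  ultimately show ?thesis by (simp add: vec_eq_iff forall_2)
qed

lemma hurwitz_quat: "hurwitz_algebra quat_scale (**) (mat 1 :: 'f::field quat) det"
proof -
  have "bilinear_map quat_scale quat_scale quat_scale ((**) :: 'f quat \<Rightarrow> _)"
    unfolding bilinear_map_def Vector_Spaces.linear_iff
    by (auto simp: vector_space_quat vec_eq_iff quat_mult_nth quat_scale_def algebra_simps)
  moreover have "quadratic_form quat_scale (det :: 'f quat \<Rightarrow> 'f)"
    unfolding quadratic_form_def bilinear_map_def Vector_Spaces.linear_iff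
    by (auto simp: vector_space_quat vector_space_field polar_det det_2 quat_scale_def
        algebra_simps power2_eq_square)
  ultimately show ?thesis
    by (auto simp: hurwitz_algebra_def polar_det_nondegenerate det_mul)
qed

lemma cayley_norm_identity:
  fixes a b c d p q r s a' b' c' d' p' q' r' s' :: "'f::comm_ring_1"
  shows "(a * a' + b * c' - (s' * p - q' * r))  *  (c * b' + d * d' - (p' * s - r' * q)) -
  (a * b' + b * d' - (s' * q - q' * s))  *  (c * a' + d * c' - (p' * r - r' * p)) +
  ((p' * a + q' * c + (p * d' - q * c'))  *  (r' * b + s' * d + (s * a' - r * b')) -
   (p' * b + q' * d + (q * a' - p * b'))  *  (r' * a + s' * c + (r * d' - s * c'))) =
  (a * d - b * c + (p * s - q * r))  *  (a' * d' - b' * c' + (p' * s' - q' * r'))"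
  by (simp add: algebra_simps)

lemma hurwitz_cayley:
  "hurwitz_algebra cayley_scale cayley_mult (mat 1, 0 :: 'f::field quat) cayley_norm"
proof -
  have "bilinear_map cayley_scale cayley_scale cayley_scale
      (cayley_mult :: 'f quat \<times> 'f quat \<Rightarrow> _)"
    unfolding bilinear_map_def Vector_Spaces.linear_iff
    by (auto simp: vector_space_cayley cayley_mult_def cd_mult_def cayley_scale_apply vec_eq_iff
        forall_2 quat_mult_nth quat_bar_nth quat_scale_def algebra_simps)
  moreover have "cayley_mult (mat 1, 0) x = x \<and> cayley_mult x (mat 1, 0) = x"
    for x :: "'f quat \<times> 'f quat"
    by (cases x) (auto simp: cayley_mult_def cd_mult_def vec_eq_iff forall_2 quat_mult_nth
        quat_bar_nth mat_def)
  moreover have "cayley_norm (cayley_scale c x) = c ^ 2 * cayley_norm x"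
    for c and x :: "'f quat \<times> 'f quat"
    by (cases x) (simp add: cayley_norm_def cd_norm_def det_2 cayley_scale_apply quat_scale_def
        algebra_simps power2_eq_square)
  moreover have "bilinear_map cayley_scale cayley_scale (*)
      (polar (cayley_norm :: 'f quat \<times> 'f quat \<Rightarrow> 'f))"
    unfolding bilinear_map_def Vector_Spaces.linear_iff
    by (auto simp: vector_space_cayley vector_space_field polar_cayley_norm polar_det
        cayley_scale_apply quat_scale_def algebra_simps)
  moreover have "x = 0" if "\<forall>y. polar cayley_norm x y = 0" for x :: "'f quat \<times> 'f quat"
  proof -
    obtain a b where x: "x = (a, b)" by (cases x)
    have "polar det a y = 0" for y using that[rule_format, of "(y, 0)"]
      by (simp add: x polar_cayley_norm) (simp add: polar_det)
    moreover have "polar det b y = 0" for y using that[rule_format, of "(0, y)"]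
      by (simp add: x polar_cayley_norm) (simp add: polar_det)
    ultimately show ?thesis by (simp add: x polar_det_nondegenerate zero_prod_def)
  qed
  moreover have "cayley_norm (cayley_mult x y) = cayley_norm x * cayley_norm y"
    for x y :: "'f quat \<times> 'f quat"
    by (cases x; cases y) (simp add: cayley_mult_def cd_mult_def cayley_norm_def cd_norm_def det_2
        quat_mult_nth quat_bar_nth, rule cayley_norm_identity)
  ultimately show ?thesis by (simp add: hurwitz_algebra_def quadratic_form_def)
qed

text \<open>A model of the tensor square of a plane, so that \<^const>\<open>is_tensor_product\<close> is satisfiable there.\<close>

lemma tensor_square_exists:
  fixes sV :: "'f::field \<Rightarrow> 'v::ab_group_add \<Rightarrow> 'v"
  assumes V: "vector_space sV" and dim: "vector_space.dim sV UNIV = 2"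
  shows "\<exists>tens :: 'v \<Rightarrow> 'v \<Rightarrow> 'f quat. is_tensor_product sV sV quat_scale tens"
proof -
  interpret V: vector_space sV by (rule V)
  obtain B where B: "V.independent B" "V.span B = UNIV" "card B = 2"
    by (rule V.basis_exists[of UNIV]) (use dim in auto)
  then obtain e1 e2 where e: "B = {e1, e2}" "e1 \<noteq> e2" by (auto simp: card_2_iff)
  define r :: "2 \<Rightarrow> 'v \<Rightarrow> 'f" where "r i v = V.representation B v (if i = 1 then e1 else e2)" for i v
  define b :: "2 \<Rightarrow> 'v" where "b i = (if i = 1 then e1 else e2)" for i
  define tens :: "'v \<Rightarrow> 'v \<Rightarrow> 'f quat" where "tens u v = (\<chi> i j. r i u * r j v)" for u v
  have r_add: "r i (u + v) = r i u + r i v" and r_scale: "r i (sV c u) = c * r i u" for i u v c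
    using B by (simp_all add: r_def V.representation_add V.representation_scale)
  have r_b: "r i (b j) = (if i = j then 1 else 0)" for i j
    using e B exhaust_2[of i] exhaust_2[of j]
    by (auto simp: r_def b_def V.representation_basis)
  have expand: "v = sV (r 1 v) (b 1) + sV (r 2 v) (b 2)" for v
    using V.sum_representation_eq[OF B(1), of v B] B e by (simp add: r_def b_def)
  have tb: "bilinear_map sV sV quat_scale tens"
    unfolding bilinear_map_def Vector_Spaces.linear_iff
    by (auto simp: V vector_space_quat tens_def r_add r_scale vec_eq_iff quat_scale_def algebra_simps)
  have tens_b: "tens (b i) (b j) $ k $ l = (if i = k \<and> j = l then 1 else 0)" for i j k l
    by (auto simp: tens_def r_b)
  have mat: "M = quat_scale (M$1$1) (tens (b 1) (b 1)) + quat_scale (M$1$2) (tens (b 1) (b 2))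
      + quat_scale (M$2$1) (tens (b 2) (b 1)) + quat_scale (M$2$2) (tens (b 2) (b 2))" for M
    by (simp add: vec_eq_iff forall_2 quat_scale_def tens_b)
  show ?thesis
    unfolding is_tensor_product_def
  proof (intro exI conjI allI impI)
    fix f :: "'v \<Rightarrow> 'v \<Rightarrow> 'f" assume f: "bilinear_map sV sV (*) f"
    define g where "g M = M$1$1 * f (b 1) (b 1) + M$1$2 * f (b 1) (b 2)
        + M$2$1 * f (b 2) (b 1) + M$2$2 * f (b 2) (b 2)" for M :: "'f quat"
    have gl: "Vector_Spaces.linear quat_scale (*) g"
      by (auto simp: Vector_Spaces.linear_iff vector_space_quat vector_space_field g_def
          quat_scale_def algebra_simps)
    have fl: "f (sV c u + sV d u') v = c * f u v + d * f u' v"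
      "f v (sV c u + sV d u') = c * f v u + d * f v u'" for c d u u' v
      using f by (auto simp: bilinear_map_def Vector_Spaces.linear_iff)
    have gt: "g (tens u v) = f u v" for u v
      by (subst (2) expand[of u], subst (2) expand[of v])
        (simp add: fl g_def tens_def algebra_simps)
    have "h = g" if h: "Vector_Spaces.linear quat_scale (*) h" "\<forall>u v. h (tens u v) = f u v" for h
    proof
      fix M show "h M = g M"
        by (subst mat[of M]) (use h in \<open>simp add: Vector_Spaces.linear_iff g_def\<close>)
    qed
    with gl gt show "\<exists>!g. Vector_Spaces.linear quat_scale (*) g \<and> (\<forall>u v. g (tens u v) = f u v)"
      by blast
  qed (rule tb)
qed


section \<open>Isomorphisms\<close>

text \<open>Isomorphisms between algebras carried by the subspaces \<open>A\<close> and \<open>B\<close> of the ambient types.\<close>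

definition algebra_iso ::
  "('f::field \<Rightarrow> 'x::ab_group_add \<Rightarrow> 'x) \<Rightarrow> ('x \<Rightarrow> 'x \<Rightarrow> 'x) \<Rightarrow> 'x set \<Rightarrow>
   ('f \<Rightarrow> 'y::ab_group_add \<Rightarrow> 'y) \<Rightarrow> ('y \<Rightarrow> 'y \<Rightarrow> 'y) \<Rightarrow> 'y set \<Rightarrow> ('x \<Rightarrow> 'y) \<Rightarrow> bool" where
  "algebra_iso sA mA A sB mB B \<phi> \<longleftrightarrow>
     bij_betw \<phi> A B \<and>
     (\<forall>x\<in>A. \<forall>y\<in>A. \<phi> (x + y) = \<phi> x + \<phi> y) \<and>
     (\<forall>c. \<forall>x\<in>A. \<phi> (sA c x) = sB c (\<phi> x)) \<and>
     (\<forall>x\<in>A. \<forall>y\<in>A. \<phi> (mA x y) = mB (\<phi> x) (\<phi> y))"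

definition is_subalgebra ::
  "('f::field \<Rightarrow> 'x::ab_group_add \<Rightarrow> 'x) \<Rightarrow> ('x \<Rightarrow> 'x \<Rightarrow> 'x) \<Rightarrow> 'x set \<Rightarrow> bool" where
  "is_subalgebra s m A \<longleftrightarrow> module.subspace s A \<and> (\<forall>x\<in>A. \<forall>y\<in>A. m x y \<in> A)"

definition is_split_para_octonion ::
  "('f::field \<Rightarrow> 'x::ab_group_add \<Rightarrow> 'x) \<Rightarrow> ('x \<Rightarrow> 'x \<Rightarrow> 'x) \<Rightarrow> ('x \<Rightarrow> 'f) \<Rightarrow> 'x set \<Rightarrow> bool" where
  "is_split_para_octonion s m q A \<longleftrightarrow>
     (\<exists>\<phi>. algebra_iso s m A cayley_scale para_cayley_mult UNIV \<phi> \<and>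
          (\<forall>x\<in>A. cayley_norm (\<phi> x) = q x))"

definition is_split_para_quaternion ::
  "('f::field \<Rightarrow> 'x::ab_group_add \<Rightarrow> 'x) \<Rightarrow> ('x \<Rightarrow> 'x \<Rightarrow> 'x) \<Rightarrow> ('x \<Rightarrow> 'f) \<Rightarrow> 'x set \<Rightarrow> bool" where
  "is_split_para_quaternion s m q A \<longleftrightarrow>
     (\<exists>\<phi>. algebra_iso s m A quat_scale para_quat_mult UNIV \<phi> \<and> (\<forall>x\<in>A. det (\<phi> x) = q x))"


section \<open>The algebra on two copies of the tensor square\<close>

text \<open>The displayed product formula holds for all pure tensors, including zero ones, so it fixes
  each of the four bilinear component maps.\<close>

definition S8_product ::
  "('f::field \<Rightarrow> 't::ab_group_add \<Rightarrow> 't) \<Rightarrow> ('v \<Rightarrow> 'v \<Rightarrow> 't) \<Rightarrow> ('v \<Rightarrow> 'v \<Rightarrow> 'f) \<Rightarrow>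
   ('t \<times> 't \<Rightarrow> 't \<times> 't \<Rightarrow> 't \<times> 't) \<Rightarrow> bool" where
  "S8_product sT tens w m \<longleftrightarrow>
     (let s = module_prod.scale sT sT in bilinear_map s s s m) \<and>
     (\<forall>a b c d a' b' c' d'.
        m (tens a b, tens c d) (tens a' b', tens c' d') =
          (sT (w b a') (tens b' a) - sT (w d d') (tens c c'),
           - sT (w a c') (tens b d') - sT (w c b') (tens a' d)))"

definition S8_norm ::
  "('f::field \<Rightarrow> 't::ab_group_add \<Rightarrow> 't) \<Rightarrow> ('v \<Rightarrow> 'v \<Rightarrow> 't) \<Rightarrow> ('v \<Rightarrow> 'v \<Rightarrow> 'f) \<Rightarrow>
   ('t \<times> 't \<Rightarrow> 'f) \<Rightarrow> bool" where
  "S8_norm sT tens w q \<longleftrightarrow>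
     quadratic_form (module_prod.scale sT sT) q \<and>
     (\<forall>a b c d a' b' c' d'.
        polar q (tens a b, tens c d) (tens a' b', tens c' d') = w a a' * w b b' + w c c' * w d d')"

end

theory Submission
  imports Defs
begin

text \<open>The plane has a basis \<open>e\<^sub>1, e\<^sub>2\<close> with \<open>w e\<^sub>1 e\<^sub>2 = 1\<close>.  Sending \<open>a \<otimes> b\<close> to the endomorphism
  \<open>x \<mapsto> \<langle>a|x\<rangle> b\<close>, written as a matrix in this basis, identifies \<open>V \<otimes> V\<close> with the 2 by 2 matrices.
  Applied to both summands, this map turns the displayed polar form into that of the Cayley norm and
  the displayed product into the para-Cayley product.  Both sides being bilinear, this has to be
  checked on pure tensors only, where it is an identity between coordinates.\<close>

section \<open>Linear and bilinear maps determined by their values on pure tensors\<close>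

lemma linear_imp_vector_spaces:
  assumes "Vector_Spaces.linear s1 s2 f"
  shows "vector_space s1" "vector_space s2"
  using assms by (auto simp: Vector_Spaces.linear_iff)

lemma linear_compose_linear:
  assumes "Vector_Spaces.linear s1 s2 f" "Vector_Spaces.linear s2 s3 g"
  shows "Vector_Spaces.linear s1 s3 (\<lambda>x. g (f x))"
  using assms by (auto simp: Vector_Spaces.linear_iff)

text \<open>Both maps factor the same bilinear map \<open>\<lambda>u v. g (tens u v)\<close> through
  \<open>tens\<close>, and such a factorization is unique.\<close>

lemma tensor_product_linear_eqI:
  assumes T: "is_tensor_product sU sV sT tens"
    and g: "Vector_Spaces.linear sT sW g" and h: "Vector_Spaces.linear sT sW h"
    and eq: "\<And>u v. g (tens u v) = h (tens u v)"
  shows "g = h"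
proof -
  have "bilinear_map sU sV sT tens"
    using T by (simp add: is_tensor_product_def)
  then have "bilinear_map sU sV sW (\<lambda>u v. g (tens u v))"
    using g by (auto simp: bilinear_map_def Vector_Spaces.linear_iff)
  from tensor_product_universal[OF T this] g h eq show ?thesis
    by metis
qed

context
  fixes s1 :: "'f::field \<Rightarrow> 'x::ab_group_add \<Rightarrow> 'x" and s2 :: "'f \<Rightarrow> 'y::ab_group_add \<Rightarrow> 'y"
  assumes s1: "vector_space s1" and s2: "vector_space s2"
begin

lemma prod_scale_apply: "module_prod.scale s1 s2 c (x, y) = (s1 c x, s2 c y)"
proof -
  have "module_prod s1 s2"
    using s1 s2 by (simp add: module_prod_def module_pair_def module_iff_vector_space)
  then show ?thesis
    by (simp add: module_prod.scale_def)
qed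

lemma vector_space_prod_scale: "vector_space (module_prod.scale s1 s2)"
proof -
  interpret A: vector_space s1 by (rule s1)
  interpret B: vector_space s2 by (rule s2)
  show ?thesis
    by unfold_locales
      (auto simp: prod_scale_apply A.scale_right_distrib A.scale_left_distrib
        B.scale_right_distrib B.scale_left_distrib split: prod.splits)
qed

lemma linear_inl: "Vector_Spaces.linear s1 (module_prod.scale s1 s2) (\<lambda>x. (x, 0))"
proof -
  interpret B: vector_space s2 by (rule s2)
  show ?thesis
    using s1 vector_space_prod_scale by (simp add: Vector_Spaces.linear_iff prod_scale_apply)
qed

lemma linear_inr: "Vector_Spaces.linear s2 (module_prod.scale s1 s2) (\<lambda>y. (0, y))"
proof -
  interpret A: vector_space s1 by (rule s1)
  show ?thesis
    using s2 vector_space_prod_scale by (simp add: Vector_Spaces.linear_iff prod_scale_apply)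
qed

end

text \<open>Every vector is \<open>(x, 0) + (0, y)\<close>. Since \<open>tens 0 v = 0\<close>, the
  pair \<open>(tens a b, 0)\<close> is again a pair of pure tensors, so uniqueness on the tensor
  product applies to each summand separately.\<close>

lemma pure_pairs_linear_eqI:
  fixes sU :: "'f::field \<Rightarrow> 'u::ab_group_add \<Rightarrow> 'u"
    and g :: "'t::ab_group_add \<times> 't \<Rightarrow> 'w::ab_group_add"
  assumes T: "is_tensor_product sU sV sT tens"
    and g: "Vector_Spaces.linear (module_prod.scale sT sT) sW g"
    and h: "Vector_Spaces.linear (module_prod.scale sT sT) sW h"
    and eq: "\<And>a b c d. g (tens a b, tens c d) = h (tens a b, tens c d)"
  shows "g = h"
proof
  fix x :: "'t \<times> 't"
  have "bilinear_map sU sV sT tens"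
    using T by (simp add: is_tensor_product_def)
  then have lin: "Vector_Spaces.linear sU sT (\<lambda>u. tens u v)" for v
    by (simp add: bilinear_map_def)
  have vT: "vector_space sT"
    using linear_imp_vector_spaces[OF lin] by blast
  have t0: "tens 0 v = 0" for v
    using lin[of v] unfolding Vector_Spaces.linear_iff by (metis add_cancel_right_right)
  have "(\<lambda>y. g (y, 0)) = (\<lambda>y. h (y, 0))"
    by (rule tensor_product_linear_eqI[OF T])
      (use linear_compose_linear[OF linear_inl[OF vT vT]] g h eq[of _ _ 0] t0 in auto)
  moreover have "(\<lambda>y. g (0, y)) = (\<lambda>y. h (0, y))"
    by (rule tensor_product_linear_eqI[OF T])
      (use linear_compose_linear[OF linear_inr[OF vT vT]] g h eq[of 0] t0 in auto)
  moreover have "x = (fst x, 0) + (0, snd x)"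
    by simp
  moreover have "g (y + z) = g y + g z" "h (y + z) = h y + h z" for y z
    using g h unfolding Vector_Spaces.linear_iff by blast+
  ultimately show "g x = h x"
    by metis
qed

text \<open>The linear criterion is used twice: first in the second argument with the first one
  pure, then in the first argument with the second one arbitrary.\<close>

lemma pure_pairs_bilinear_eqI:
  fixes sU :: "'f::field \<Rightarrow> 'u::ab_group_add \<Rightarrow> 'u"
    and sT :: "'f \<Rightarrow> 't::ab_group_add \<Rightarrow> 't"
  defines "s \<equiv> module_prod.scale sT sT"
  assumes T: "is_tensor_product sU sV sT tens"
    and f: "bilinear_map s s sW f" and g: "bilinear_map s s sW g"
    and eq: "\<And>a b c d a' b' c' d'. f (tens a b, tens c d) (tens a' b', tens c' d') =
      g (tens a b, tens c d) (tens a' b', tens c' d')"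
  shows "f = g"
proof -
  have 1: "f (tens a b, tens c d) = g (tens a b, tens c d)" for a b c d
    by (rule pure_pairs_linear_eqI[where sW = sW, OF T]) (use f g eq in \<open>auto simp: bilinear_map_def s_def\<close>)
  have "(\<lambda>x. f x y) = (\<lambda>x. g x y)" for y
    by (rule pure_pairs_linear_eqI[where sW = sW, OF T]) (use f g 1 in \<open>simp_all add: bilinear_map_def s_def del: split_paired_All\<close>)
  then show ?thesis
    by (metis ext)
qed

lemma bilinear_map_compose:
  assumes f: "bilinear_map sU sV sW f"
    and g: "Vector_Spaces.linear sX sU g" and h: "Vector_Spaces.linear sY sV h"
    and k: "Vector_Spaces.linear sW sZ k"
  shows "bilinear_map sX sY sZ (\<lambda>x y. k (f (g x) (h y)))"
  using f linear_compose_linear[OF linear_compose_linear[OF g] k]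
    linear_compose_linear[OF linear_compose_linear[OF h] k]
  unfolding bilinear_map_def by blast

section \<open>The para-Hurwitz products in explicit form\<close>

lemma para_cayley_mult_apply:
  "para_cayley_mult (x, y) (x', y') =
    (quat_bar x ** quat_bar x' - quat_bar y' ** y, - (y' ** quat_bar x) - y ** x')"
  \<comment> \<open>Conjugation negates both second components. The two signs cancel in the term
    \<open>quat_bar y' ** y\<close>, and \<open>x'\<close> loses its bar because it is conjugated
    twice.\<close>
  by (simp add: para_cayley_mult_def para_mult_def std_inv_cayley cayley_mult_def cd_mult_def
      vec_eq_iff forall_2 quat_mult_nth quat_bar_nth)

lemma para_quat_mult_apply: "para_quat_mult x y = quat_bar x ** quat_bar y"
  by (simp add: para_quat_mult_def para_mult_def quat_bar_def)

lemma bilinear_para_cayley_mult: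
  "bilinear_map cayley_scale cayley_scale cayley_scale
    (para_cayley_mult :: 'f::field quat \<times> 'f quat \<Rightarrow> _)"
  unfolding bilinear_map_def Vector_Spaces.linear_iff
  by (auto simp: vector_space_cayley para_cayley_mult_apply cayley_scale_apply vec_eq_iff
      forall_2 quat_mult_nth quat_bar_nth quat_scale_def algebra_simps)

lemma quadratic_form_cayley_norm:
  "quadratic_form cayley_scale (cayley_norm :: 'f::field quat \<times> 'f quat \<Rightarrow> 'f)"
  using hurwitz_cayley unfolding hurwitz_algebra_def by blast

section \<open>Recovering a norm from its polar form when 2 is nonzero\<close>

lemma quadratic_form_polar_self:
  assumes "quadratic_form s q"
  shows "polar q x x = 2 * q x"
proof -
  have "vector_space s"
    using assms by (simp add: quadratic_form_def bilinear_map_def Vector_Spaces.linear_iff)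
  then interpret vector_space s .
  have "x + x = s 2 x"
    using scale_left_distrib[of 1 1 x] by simp
  moreover have "q (s 2 x) = 2 ^ 2 * q x"
    using assms by (simp add: quadratic_form_def)
  ultimately show ?thesis
    by (simp add: polar_def)
qed

lemma two_neq_zero_if_CHAR_neq_2:
  assumes "CHAR('f::field) \<noteq> 2"
  shows "(2::'f) \<noteq> 0"
proof
  assume "(2::'f) = 0"
  then have "CHAR('f) dvd 2"
    using of_nat_eq_0_iff_char_dvd[where 'a = 'f, of 2] by simp
  \<comment> \<open>Primality of 2 leaves two divisors; characteristic 1 is impossible because
    \<open>0 \<noteq> 1\<close> in a field.\<close>
  then have "CHAR('f) = 1 \<or> CHAR('f) = 2"
    using two_is_prime_nat unfolding prime_nat_iff by blast
  then show False
    using assms CHAR_not_1 by simp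
qed

section \<open>Symplectic bases of the plane and matrices of endomorphisms\<close>

lemma symplectic_basis_exists:
  fixes sV :: "'f::field \<Rightarrow> 'v::ab_group_add \<Rightarrow> 'v"
  assumes V: "vector_space sV" "vector_space.dim sV UNIV = 2"
    and w: "bilinear_map sV sV (*) w" "\<And>x. w x x = 0" "\<And>x y. w x y = - w y x"
    and nz: "w x0 y0 \<noteq> 0"
  obtains e1 e2 where "w e1 e2 = 1" "\<And>x. x = sV (w x e2) e1 + sV (w e1 x) e2"
proof -
  interpret V: vector_space sV by (rule V)
  have wl: "w (x + y) z = w x z + w y z" "w z (x + y) = w z x + w z y"
    "w (sV c x) z = c * w x z" "w z (sV c x) = c * w z x" for x y z c
    using w(1) by (auto simp: bilinear_map_def Vector_Spaces.linear_iff)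
  obtain B where B: "V.independent B" "V.span B = UNIV" "card B = 2"
    by (rule V.basis_exists[of UNIV]) (use V(2) in auto)
  then obtain b1 b2 where b: "B = {b1, b2}" "b1 \<noteq> b2"
    by (auto simp: card_2_iff)
  have expand: "\<exists>p q. x = sV p b1 + sV q b2" for x
  proof -
    have "sV (V.representation B x b1) b1 + sV (V.representation B x b2) b2 = x"
      using V.sum_representation_eq[OF B(1), of x B] B b by simp
    then show ?thesis by metis
  qed
  \<comment> \<open>Expanding both arguments in the basis makes every value of \<open>w\<close> a
    multiple of \<open>w b1 b2\<close>.\<close>
  have nz': "w b1 b2 \<noteq> 0"
  proof
    assume 0: "w b1 b2 = 0"
    obtain p q p' q' where "x0 = sV p b1 + sV q b2" "y0 = sV p' b1 + sV q' b2"
      using expand by metis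
    then have "w x0 y0 = 0"
      using 0 w(3)[of b2 b1] by (simp add: wl w(2))
    with nz show False by simp
  qed
  \<comment> \<open>Rescaling \<open>b2\<close> alone normalizes the pairing to 1; \<open>b1\<close>
    itself serves as the first basis vector.\<close>
  define e2 where "e2 = sV (inverse (w b1 b2)) b2"
  have one: "w b1 e2 = 1"
    using nz' by (simp add: e2_def wl)
  have "x = sV (w x e2) b1 + sV (w b1 x) e2" for x
  proof -
    obtain p q where x: "x = sV p b1 + sV q b2"
      using expand by metis
    then have "x = sV p b1 + sV (q * w b1 b2) e2"
      using nz' by (simp add: e2_def)
    moreover from this have "w x e2 = p" "w b1 x = q * w b1 b2"
      using one by (simp_all add: wl w(2))
    ultimately show ?thesis by simp
  qed
  with one that show thesis by blast
qed

locale symplectic_plane =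
  fixes sV :: "'f::field \<Rightarrow> 'v::ab_group_add \<Rightarrow> 'v"
    and w :: "'v \<Rightarrow> 'v \<Rightarrow> 'f" and e1 e2 :: 'v
  assumes bilinear_w: "bilinear_map sV sV (*) w"
    and w_self [simp]: "w x x = 0"
    and w_skew: "w x y = - w y x"
    and w_basis [simp]: "w e1 e2 = 1"
    and expand: "x = sV (w x e2) e1 + sV (w e1 x) e2"
begin

sublocale V: vector_space sV
  using bilinear_w by (simp add: bilinear_map_def Vector_Spaces.linear_iff)

lemma w_linear [simp]:
  "w (x + y) z = w x z + w y z" "w z (x + y) = w z x + w z y"
  "w (sV c x) z = c * w x z" "w z (sV c x) = c * w z x"
  using bilinear_w by (auto simp: bilinear_map_def Vector_Spaces.linear_iff)

lemma w_basis' [simp]: "w e2 e1 = -1"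
  by (subst w_skew) simp

text \<open>In a symplectic basis the form is the 2 by 2 determinant of the coordinates. This
  rewrites a pairing of two arbitrary vectors in terms of their coordinates.\<close>

lemma w_coords: "w x y = w x e2 * w e1 y - w e1 x * w y e2"
  by (subst expand[of x], subst expand[of y]) (simp add: w_skew[of e2 y] algebra_simps w_skew[of e2 x])

definition basis :: "2 \<Rightarrow> 'v" where "basis i = (if i = 1 then e1 else e2)"

text \<open>By \<open>expand\<close>, pairing with the opposite basis vector reads off the
  coordinates with respect to \<open>basis\<close>.\<close>

definition coord :: "2 \<Rightarrow> 'v \<Rightarrow> 'f" where "coord i x = (if i = 1 then w x e2 else w e1 x)"

text \<open>The matrix of an endomorphism in a symplectic basis gives the identification of the
  endomorphism algebra with the 2 by 2 matrices.\<close>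

lemma endomorphisms_iso:
  "\<exists>\<psi>. algebra_iso (\<lambda>c f x. sV c (f x)) (\<circ>) {f. Vector_Spaces.linear sV sV f}
     quat_scale (**) (UNIV :: 'f quat set) \<psi>"
proof
  define \<psi> :: "('v \<Rightarrow> 'v) \<Rightarrow> 'f quat" where "\<psi> f = (\<chi> i j. coord i (f (basis j)))" for f
  \<comment> \<open>The endomorphism with matrix \<open>M\<close>, which is the inverse
    construction.\<close>
  define \<theta> :: "'f quat \<Rightarrow> 'v \<Rightarrow> 'v" where
    "\<theta> M x = sV (M$1$1 * w x e2 + M$1$2 * w e1 x) e1 + sV (M$2$1 * w x e2 + M$2$2 * w e1 x) e2"
    for M x
  have \<theta>_lin: "Vector_Spaces.linear sV sV (\<theta> M)" for M
    unfolding Vector_Spaces.linear_iff \<theta>_def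
    by (simp add: V.vector_space_axioms algebra_simps V.scale_left_distrib V.scale_right_distrib)
  have \<psi>\<theta>: "\<psi> (\<theta> M) = M" for M
    by (simp add: \<psi>_def \<theta>_def vec_eq_iff forall_2 coord_def basis_def)
  have f_expand: "f x = sV (w x e2) (f e1) + sV (w e1 x) (f e2)"
    if "Vector_Spaces.linear sV sV f" for f x
    using that by (subst expand[of x]) (simp add: Vector_Spaces.linear_iff)
  have coord_f: "w (f x) e2 = w x e2 * w (f e1) e2 + w e1 x * w (f e2) e2"
    "w e1 (f x) = w x e2 * w e1 (f e1) + w e1 x * w e1 (f e2)"
    if "Vector_Spaces.linear sV sV f" for f x
    by (simp_all add: f_expand[OF that, of x])
  have \<theta>\<psi>: "\<theta> (\<psi> f) = f" if f: "Vector_Spaces.linear sV sV f" for f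
  proof
    fix x show "\<theta> (\<psi> f) x = f x"
      by (subst expand[of "f x"])
        (simp add: \<theta>_def \<psi>_def coord_def basis_def coord_f[OF f, of x] mult.commute)
  qed
  have "bij_betw \<psi> {f. Vector_Spaces.linear sV sV f} UNIV"
    by (rule bij_betw_byWitness[where f' = \<theta>]) (auto simp: \<theta>\<psi> \<psi>\<theta> \<theta>_lin)
  moreover have "\<psi> (\<lambda>x. sV c (f x)) = quat_scale c (\<psi> f)" "\<psi> (f + g) = \<psi> f + \<psi> g" for c f g
    by (simp_all add: \<psi>_def vec_eq_iff coord_def quat_scale_def)
  moreover have "\<psi> (f \<circ> g) = \<psi> f ** \<psi> g"
    if "Vector_Spaces.linear sV sV f" "Vector_Spaces.linear sV sV g" for f g
    by (simp add: \<psi>_def vec_eq_iff forall_2 quat_mult_nth coord_def basis_def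
        coord_f[OF that(1), of "g _"] mult.commute)
  ultimately show "algebra_iso (\<lambda>c f x. sV c (f x)) (\<circ>) {f. Vector_Spaces.linear sV sV f}
      quat_scale (**) UNIV \<psi>"
    by (simp add: algebra_iso_def)
qed

end

section \<open>The tensor square of the plane as the space of 2 by 2 matrices\<close>

locale symplectic_tensor_square = symplectic_plane sV w e1 e2
  for sV :: "'f::field \<Rightarrow> 'v::ab_group_add \<Rightarrow> 'v" and w e1 e2 +
  fixes sT :: "'f \<Rightarrow> 't::ab_group_add \<Rightarrow> 't" and tens :: "'v \<Rightarrow> 'v \<Rightarrow> 't"
  assumes tensor: "is_tensor_product sV sV sT tens"
    and two_neq_zero: "(2::'f) \<noteq> 0"
begin

abbreviation "sTT \<equiv> module_prod.scale sT sT"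

lemma bilinear_tens: "bilinear_map sV sV sT tens"
  using tensor by (simp add: is_tensor_product_def)

sublocale T: vector_space sT
  using bilinear_tens by (simp add: bilinear_map_def Vector_Spaces.linear_iff)

lemma tens_linear:
  "tens (x + y) z = tens x z + tens y z" "tens z (x + y) = tens z x + tens z y"
  "tens (sV c x) z = sT c (tens x z)" "tens z (sV c x) = sT c (tens z x)"
  using bilinear_tens by (auto simp: bilinear_map_def Vector_Spaces.linear_iff)

lemma sTT_apply: "sTT c (x, y) = (sT c x, sT c y)"
  by (rule prod_scale_apply[OF T.vector_space_axioms T.vector_space_axioms])

lemma vector_space_sTT: "vector_space sTT"
  by (rule vector_space_prod_scale[OF T.vector_space_axioms T.vector_space_axioms])

text \<open>The matrix of the endomorphism \<open>\<lambda>x. sV (w a x) b\<close>: column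
  \<open>j\<close> holds the coordinates of the image of \<open>basis j\<close>.\<close>

definition pure_matrix :: "'v \<Rightarrow> 'v \<Rightarrow> 'f quat" where
  "pure_matrix a b = (\<chi> i j. coord i b * w a (basis j))"

lemma bilinear_pure_matrix: "bilinear_map sV sV quat_scale pure_matrix"
  unfolding bilinear_map_def Vector_Spaces.linear_iff
  by (auto simp: V.vector_space_axioms vector_space_quat pure_matrix_def vec_eq_iff coord_def
      quat_scale_def algebra_simps)

lemma pure_matrix_nth:
  "pure_matrix a b $ 1 $ 1 = - (w e1 a * w b e2)" "pure_matrix a b $ 1 $ 2 = w a e2 * w b e2"
  "pure_matrix a b $ 2 $ 1 = - (w e1 a * w e1 b)" "pure_matrix a b $ 2 $ 2 = w a e2 * w e1 b"
  by (simp_all add: pure_matrix_def coord_def basis_def w_skew[of a e1] mult.commute)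

definition \<Phi> :: "'t \<Rightarrow> 'f quat" where
  "\<Phi> = (THE g. Vector_Spaces.linear sT quat_scale g \<and> (\<forall>a b. g (tens a b) = pure_matrix a b))"

text \<open>The target is a space of matrices, so the derived universal property is needed; the
  definition of a tensor product speaks of scalar-valued maps only.\<close>

lemma linear_\<Phi>: "Vector_Spaces.linear sT quat_scale \<Phi>"
  and \<Phi>_tens: "\<Phi> (tens a b) = pure_matrix a b"
  using theI'[OF tensor_product_universal[OF tensor bilinear_pure_matrix]]
  unfolding \<Phi>_def[symmetric] by auto

lemma \<Phi>_linear:
  "\<Phi> (x + y) = \<Phi> x + \<Phi> y" "\<Phi> (sT c x) = quat_scale c (\<Phi> x)"
  using linear_\<Phi> by (auto simp: Vector_Spaces.linear_iff)

lemma \<Phi>_0 [simp]: "\<Phi> 0 = 0"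
  using \<Phi>_linear(1)[of 0 0] by simp

text \<open>The inverse of \<Phi>, read off on matrix units: \<Phi> sends \<open>tens e1 e1\<close>
  and \<open>tens e1 e2\<close> to the units at (1,2) and (2,2), and \<open>tens e2 e1\<close> and
  \<open>tens e2 e2\<close> to minus those at (1,1) and (2,1).\<close>

definition \<Psi> :: "'f quat \<Rightarrow> 't" where
  "\<Psi> M = sT (M$1$2) (tens e1 e1) + sT (M$2$2) (tens e1 e2)
     + sT (- M$1$1) (tens e2 e1) + sT (- M$2$1) (tens e2 e2)"

lemma linear_\<Psi>: "Vector_Spaces.linear quat_scale sT \<Psi>"
  unfolding Vector_Spaces.linear_iff \<Psi>_def
  by (simp add: T.vector_space_axioms vector_space_quat quat_scale_def T.scale_left_distrib
      T.scale_right_distrib T.scale_left_diff_distrib T.scale_right_diff_distrib)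

lemma \<Phi>_\<Psi>: "\<Phi> (\<Psi> M) = M"
  by (simp add: \<Psi>_def \<Phi>_linear \<Phi>_tens vec_eq_iff forall_2 pure_matrix_nth quat_scale_def del: T.scale_minus_left)

lemma \<Psi>_\<Phi>: "\<Psi> (\<Phi> t) = t"
proof -
  have "\<Psi> (pure_matrix a b) = tens a b" for a b
    by (subst (2) expand[of a], subst (2) expand[of b])
      (simp add: \<Psi>_def pure_matrix_nth tens_linear T.scale_right_distrib mult.commute)
  moreover have "Vector_Spaces.linear sT sT (\<lambda>x. x)"
    by (simp add: Vector_Spaces.linear_iff T.vector_space_axioms)
  ultimately have "(\<lambda>t. \<Psi> (\<Phi> t)) = (\<lambda>t. t)"
    by (intro tensor_product_linear_eqI[OF tensor linear_compose_linear[OF linear_\<Phi> linear_\<Psi>]])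
      (simp_all add: \<Phi>_tens)
  then show ?thesis
    by metis
qed

section \<open>Transport of the para-Cayley product and norm to pairs of tensors\<close>

definition \<Phi>2 :: "'t \<times> 't \<Rightarrow> 'f quat \<times> 'f quat" where "\<Phi>2 = map_prod \<Phi> \<Phi>"

definition \<Psi>2 :: "'f quat \<times> 'f quat \<Rightarrow> 't \<times> 't" where "\<Psi>2 = map_prod \<Psi> \<Psi>"

lemma \<Phi>2_apply: "\<Phi>2 (x, y) = (\<Phi> x, \<Phi> y)"
  by (simp add: \<Phi>2_def)

lemma \<Phi>2_\<Psi>2: "\<Phi>2 (\<Psi>2 z) = z" and \<Psi>2_\<Phi>2: "\<Psi>2 (\<Phi>2 x) = x"
  by (cases z, simp add: \<Phi>2_def \<Psi>2_def \<Phi>_\<Psi>) (cases x, simp add: \<Phi>2_def \<Psi>2_def \<Psi>_\<Phi>)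

lemma linear_\<Phi>2: "Vector_Spaces.linear sTT cayley_scale \<Phi>2"
  unfolding Vector_Spaces.linear_iff
  by (auto simp: vector_space_sTT vector_space_cayley \<Phi>2_apply \<Phi>_linear sTT_apply
      cayley_scale_apply)

lemma linear_\<Psi>2: "Vector_Spaces.linear cayley_scale sTT \<Psi>2"
  using linear_\<Psi> unfolding Vector_Spaces.linear_iff
  by (auto simp: vector_space_sTT vector_space_cayley \<Psi>2_def sTT_apply cayley_scale_apply)

lemma bij_\<Phi>2: "bij \<Phi>2"
  by (rule o_bij[of \<Psi>2]) (auto simp: \<Phi>2_\<Psi>2 \<Psi>2_\<Phi>2)

lemma \<Phi>2_eq_iff: "\<Phi>2 x = \<Phi>2 y \<longleftrightarrow> x = y"
  by (metis \<Psi>2_\<Phi>2)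

text \<open>Conceptually, conjugation sends the endomorphism of \<open>tens a b\<close> to minus
  that of \<open>tens b a\<close>, and composing those of \<open>tens a b\<close> and
  \<open>tens a' b'\<close> gives \<open>w a b'\<close> times that of \<open>tens a' b\<close>.
  These two rules yield all four terms; the proof compares matrix entries.\<close>

lemma \<Phi>2_pure_product:
  "\<Phi>2 (sT (w b a') (tens b' a) - sT (w d d') (tens c c'),
       - sT (w a c') (tens b d') - sT (w c b') (tens a' d)) =
   para_cayley_mult (\<Phi>2 (tens a b, tens c d)) (\<Phi>2 (tens a' b', tens c' d'))"
proof -
  have diff: "\<Phi> (x - y) = \<Phi> x - \<Phi> y" for x y
    using \<Phi>_linear(1)[of "x - y" y] by (simp add: eq_diff_eq)
  have minus: "\<Phi> (- x) = - \<Phi> x" for x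
    using diff[of 0 x] by simp
  show ?thesis
    unfolding \<Phi>2_apply para_cayley_mult_apply diff minus \<Phi>_linear \<Phi>_tens prod.inject vec_eq_iff forall_2
    by (simp add: quat_mult_nth quat_bar_nth quat_scale_def pure_matrix_nth w_coords[of b a']
        w_coords[of d d'] w_coords[of a c'] w_coords[of c b'] algebra_simps)
qed

text \<open>Gives existence and uniqueness of the product at once: the transported product is
  bilinear and obeys the formula, and bilinear maps agreeing on pairs of pure tensors are
  equal.\<close>

lemma S8_product_iff:
  "S8_product sT tens w m \<longleftrightarrow> m = (\<lambda>x y. \<Psi>2 (para_cayley_mult (\<Phi>2 x) (\<Phi>2 y)))" (is "_ \<longleftrightarrow> m = ?m")
proof
  have bil: "bilinear_map sTT sTT sTT ?m"
    by (rule bilinear_map_compose[OF bilinear_para_cayley_mult linear_\<Phi>2 linear_\<Phi>2 linear_\<Psi>2])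
  have pure: "?m (tens a b, tens c d) (tens a' b', tens c' d') =
      (sT (w b a') (tens b' a) - sT (w d d') (tens c c'),
       - sT (w a c') (tens b d') - sT (w c b') (tens a' d))" for a b c d a' b' c' d'
    by (simp only: \<Phi>2_pure_product[symmetric] \<Psi>2_\<Phi>2)
  show "m = ?m" if "S8_product sT tens w m"
    by (rule pure_pairs_bilinear_eqI[OF tensor])
      (use that bil pure in \<open>simp_all add: S8_product_def Let_def\<close>)
  show "S8_product sT tens w m" if "m = ?m"
    unfolding that S8_product_def Let_def using bil pure by blast
qed

lemma S8_norm_iff: "S8_norm sT tens w q \<longleftrightarrow> q = (\<lambda>x. cayley_norm (\<Phi>2 x))" (is "_ \<longleftrightarrow> q = ?q")
proof
  have polar: "polar ?q = (\<lambda>x y. polar cayley_norm (\<Phi>2 x) (\<Phi>2 y))"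
    using linear_\<Phi>2 by (simp add: fun_eq_iff polar_def Vector_Spaces.linear_iff)
  have "bilinear_map cayley_scale cayley_scale (*) (polar (cayley_norm :: 'f quat \<times> 'f quat \<Rightarrow> 'f))"
    using quadratic_form_cayley_norm unfolding quadratic_form_def by blast
  \<comment> \<open>The identity is the outer linear map \<open>k\<close> of
    \<open>bilinear_map_compose\<close>.\<close>
  moreover have "Vector_Spaces.linear (*) (*) (\<lambda>x::'f. x)"
    by (simp add: Vector_Spaces.linear_iff vector_space_field)
  ultimately have "bilinear_map sTT sTT (*) (polar ?q)"
    unfolding polar by (rule bilinear_map_compose[OF _ linear_\<Phi>2 linear_\<Phi>2])
  moreover have "?q (sTT c x) = c ^ 2 * ?q x" for c x
    using linear_\<Phi>2 quadratic_form_cayley_norm[where 'f = 'f]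
    by (simp add: Vector_Spaces.linear_iff quadratic_form_def del: split_paired_All)
  ultimately have quad: "quadratic_form sTT ?q"
    by (simp add: quadratic_form_def)
  have pure: "polar ?q (tens a b, tens c d) (tens a' b', tens c' d') =
      w a a' * w b b' + w c c' * w d d'" for a b c d a' b' c' d'
    by (simp add: polar \<Phi>2_apply \<Phi>_tens polar_cayley_norm polar_det pure_matrix_nth w_coords[of a a']
        w_coords[of b b'] w_coords[of c c'] w_coords[of d d'] algebra_simps)
  show "q = ?q" if q: "S8_norm sT tens w q"
  proof -
    have "polar q = polar ?q"
      by (rule pure_pairs_bilinear_eqI[where sW = "(*)", OF tensor])
        (use q quad pure in \<open>simp_all add: S8_norm_def quadratic_form_def\<close>)
    \<comment> \<open>The formula prescribes only the polar form. It determines the norm through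
      \<open>polar q x x = 2 * q x\<close>, where 2 can be cancelled.\<close>
    then have "2 * q x = 2 * ?q x" for x
      using q quad by (metis S8_norm_def quadratic_form_polar_self)
    then show ?thesis
      using two_neq_zero by auto
  qed
  show "S8_norm sT tens w q" if "q = ?q"
    unfolding that S8_norm_def using quad pure by blast
qed

section \<open>The split para-octonions and their para-quaternion subalgebra\<close>

lemma \<Phi>2_product:
  assumes "S8_product sT tens w m"
  shows "\<Phi>2 (m x y) = para_cayley_mult (\<Phi>2 x) (\<Phi>2 y)"
  using assms by (simp add: S8_product_iff \<Phi>2_\<Psi>2)

lemma split_para_octonion:
  assumes m: "S8_product sT tens w m" and q: "S8_norm sT tens w q"
  shows "is_split_para_octonion sTT m q UNIV"
  unfolding is_split_para_octonion_def algebra_iso_def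
  using linear_\<Phi>2 bij_\<Phi>2 q
  by (intro exI[of _ \<Phi>2]) (simp add: Vector_Spaces.linear_iff S8_norm_iff \<Phi>2_product[OF m])

text \<open>With vanishing second components only \<open>quat_bar x ** quat_bar x'\<close> survives
  in the para-Cayley product; injectivity of \<Phi>2 brings this back to tensors.\<close>

lemma product_first_copy:
  assumes "S8_product sT tens w m"
  shows "m (x, 0) (y, 0) = (\<Psi> (para_quat_mult (\<Phi> x) (\<Phi> y)), 0)"
proof -
  have "\<Phi>2 (m (x, 0) (y, 0)) = \<Phi>2 (\<Psi> (para_quat_mult (\<Phi> x) (\<Phi> y)), 0)"
    unfolding \<Phi>2_product[OF assms]
    by (simp add: \<Phi>2_apply \<Phi>_\<Psi> para_cayley_mult_apply para_quat_mult_apply vec_eq_iff quat_mult_nth)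
  then show ?thesis
    by (simp only: \<Phi>2_eq_iff)
qed

lemma first_copy_subalgebra:
  assumes "S8_product sT tens w m"
  shows "is_subalgebra sTT m (UNIV \<times> {0})"
proof -
  interpret TT: vector_space sTT by (rule vector_space_sTT)
  have "TT.subspace (UNIV \<times> {0})"
    by (auto simp: TT.subspace_def sTT_apply zero_prod_def)
  then show ?thesis
    by (auto simp: is_subalgebra_def product_first_copy[OF assms])
qed

lemma split_para_quaternion:
  assumes m: "S8_product sT tens w m" and q: "S8_norm sT tens w q"
  shows "is_split_para_quaternion sTT m q (UNIV \<times> {0})"
proof -
  have "bij_betw (\<lambda>x. \<Phi> (fst x)) (UNIV \<times> {0}) UNIV"
    by (rule bij_betw_byWitness[where f' = "\<lambda>M. (\<Psi> M, 0)"]) (auto simp: \<Phi>_\<Psi> \<Psi>_\<Phi>)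
  \<comment> \<open>The second component contributes the determinant of the zero matrix to the
    Cayley norm.\<close>
  moreover have "det (\<Phi> x) = q (x, 0)" for x
    using q by (simp add: S8_norm_iff \<Phi>2_apply cayley_norm_def cd_norm_def det_2)
  ultimately show ?thesis
    unfolding is_split_para_quaternion_def algebra_iso_def
    by (intro exI[of _ "\<lambda>x. \<Phi> (fst x)"])
      (auto simp: \<Phi>_linear \<Phi>_\<Psi> sTT_apply product_first_copy[OF m])
qed

end

text \<open>Unique existence of \<open>m\<close> and \<open>q\<close> makes the implication about
  them non-vacuous and specific to one algebra. The last conjunct supplies the identification of the
  endomorphisms of the plane with the split quaternions.\<close>

theorem mainTheorem1:
  fixes sV :: "'f::field \<Rightarrow> 'v::ab_group_add \<Rightarrow> 'v"
    and w :: "'v \<Rightarrow> 'v \<Rightarrow> 'f"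
    and sT :: "'f \<Rightarrow> 't::ab_group_add \<Rightarrow> 't"
    and tens :: "'v \<Rightarrow> 'v \<Rightarrow> 't"
  assumes char: "CHAR('f) \<noteq> 2"
    and V: "vector_space sV" "vector_space.dim sV UNIV = 2"
    and w: "bilinear_map sV sV (*) w" "\<forall>x y. w x y = - w y x" "\<exists>x y. w x y \<noteq> 0"
    and T: "is_tensor_product sV sV sT tens"
  shows "(\<exists>!m. S8_product sT tens w m) \<and> (\<exists>!q. S8_norm sT tens w q) \<and>
    (\<forall>m q. S8_product sT tens w m \<and> S8_norm sT tens w q \<longrightarrow>
       is_split_para_octonion (module_prod.scale sT sT) m q UNIV \<and>
       is_subalgebra (module_prod.scale sT sT) m (UNIV \<times> {0}) \<and>
       is_split_para_quaternion (module_prod.scale sT sT) m q (UNIV \<times> {0})) \<and>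
    (\<exists>\<psi>. algebra_iso (\<lambda>c f x. sV c (f x)) (\<circ>) {f. Vector_Spaces.linear sV sV f}
           quat_scale (**) (UNIV :: 'f quat set) \<psi>)"
proof -
  have two: "(2::'f) \<noteq> 0"
    by (rule two_neq_zero_if_CHAR_neq_2[OF char])
  have skew: "w x y = - w y x" for x y
    using w(2) by blast
  \<comment> \<open>Skew-symmetry yields \<open>2 * w x x = 0\<close>, so the form is alternating
    once 2 is cancelled.\<close>
  have alt: "w x x = 0" for x
  proof -
    have "2 * w x x = 0"
      using skew[of x x] by (metis add.right_inverse mult_2)
    with two show ?thesis by simp
  qed
  obtain x0 y0 where "w x0 y0 \<noteq> 0"
    using w(3) by blast
  then obtain e1 e2 where "w e1 e2 = 1" "\<And>x. x = sV (w x e2) e1 + sV (w e1 x) e2"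
    using symplectic_basis_exists[OF V w(1) alt skew] by metis
  then interpret symplectic_tensor_square sV w e1 e2 sT tens
    using w(1) alt skew T two by unfold_locales
  show ?thesis
    using endomorphisms_iso split_para_octonion first_copy_subalgebra split_para_quaternion
    by (auto simp: S8_product_iff S8_norm_iff)
qed

end
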